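(* For every nonnegative integer $n$, $\phi_{2,-1}(5n+4)\equiv 0 \pmod 5$.
   Context: $\phi_{2,-1}(n)$ is defined by $\sum_{n\ge0}\phi_{2,-1}(n)q^n=$ the coefficient of $z^{-1}$ in the formal product $\prod_{\lambda=0}^{\infty}(1+zq^{\lambda+1}+z^2q^{2(\lambda+1)})(1+z^{-1}q^{\lambda}+z^{-2}q^{2\lambda})$. Equivalently, $\phi_{2,-1}(n)$ is the number of two-rowed arrays with top row $(a_1\ge\cdots\ge a_{m_1})$ and bottom row $(b_1\ge\cdots\ge b_{m_2})$ of nonnegative integers, with $m_1-m_2=-1$, each nonnegative integer appearing at most twice in each row, and weight $m_1+\sum a_i+\sum b_j=n$. *)

theory Defs
  imports
    "HOL-Analysis.Analysis"
    "HOL-Computational_Algebra.Formal_Laurent_Series"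
    "HOL-Number_Theory.Cong"
begin

text \<open>
  The formal product is taken in the ring of power series in $q$ over the Laurent series in $z$:
  \<^term>\<open>fps_X\<close> is $q$, and \<^term>\<open>fls_X\<close>, \<^term>\<open>fls_X_inv\<close> are $z$, $z^{-1}$. The infinite product
  converges in the library's $q$-adic metric on formal power series; the coefficient ring
  carries no topology here.
\<close>

definition phi_2_minus1_factor :: "nat \<Rightarrow> int fls fps" where
  "phi_2_minus1_factor l =
     (1 + fps_const fls_X * fps_X ^ (l + 1) + fps_const (fls_X ^ 2) * fps_X ^ (2 * (l + 1))) *
     (1 + fps_const fls_X_inv * fps_X ^ l + fps_const (fls_X_inv ^ 2) * fps_X ^ (2 * l))"

definition phi_2_minus1 :: "nat \<Rightarrow> int" where
  "phi_2_minus1 n = fls_nth (fps_nth (prodinf phi_2_minus1_factor) n) (- 1)"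

text \<open>
  The partial products do converge to \<^term>\<open>prodinf phi_2_minus1_factor\<close>, so the description
  operator in \<^const>\<open>prodinf\<close> is not applied vacuously.
\<close>

lemma phi_2_minus1_factor_eq_1_plus:
  "\<exists>g. phi_2_minus1_factor l = 1 + fps_X ^ l * g"
proof -
  define a b x :: "int fls fps" where "a = fps_const fls_X" and "b = fps_const fls_X_inv"
    and "x = fps_X ^ l"
  have "phi_2_minus1_factor l =
      (1 + a * (x * fps_X) + a ^ 2 * (x * fps_X) ^ 2) * (1 + b * x + b ^ 2 * x ^ 2)"
    unfolding phi_2_minus1_factor_def a_def b_def x_def
    by (simp only: fps_const_power power_add power_one_right mult.commute[of 2] power_mult)
  also have "\<dots> = 1 + x * ((a * fps_X + a ^ 2 * fps_X * (x * fps_X)) * (1 + b * x + b ^ 2 * x ^ 2)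
      + (b + b ^ 2 * x))"
    by (simp add: algebra_simps power2_eq_square)
  finally show ?thesis unfolding x_def by blast
qed

lemma has_prod_phi_2_minus1_factor:
  "phi_2_minus1_factor has_prod prodinf phi_2_minus1_factor"
proof -
  define P where "P n = (\<Prod>i\<le>n. phi_2_minus1_factor i)" for n
  define L where "L = Abs_fps (\<lambda>k. fps_nth (P k) k)"
  have step: "fps_nth (P (Suc n)) k = fps_nth (P n) k" if "k \<le> n" for n k
  proof -
    obtain g where g: "phi_2_minus1_factor (Suc n) = 1 + fps_X ^ Suc n * g"
      using phi_2_minus1_factor_eq_1_plus by blast
    have "P (Suc n) = P n * (1 + fps_X ^ Suc n * g)"
      unfolding P_def g[symmetric] by simp
    also have "\<dots> = P n + fps_X ^ Suc n * (P n * g)"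
      by (simp only: distrib_left mult_1_right mult.left_commute)
    finally show ?thesis
      using that by (simp add: fps_X_power_mult_nth del: power_Suc)
  qed
  have stable: "fps_nth (P n) k = fps_nth (P k) k" if "k \<le> n" for n k
    using that by (induction n rule: dec_induct) (simp_all add: step)
  have "P \<longlonglongrightarrow> L"
  proof (rule tendsto_fpsI)
    fix k
    show "\<forall>\<^sub>F n in sequentially. fps_nth (P n) k = fps_nth L k"
      using eventually_ge_at_top[of k] by eventually_elim (unfold L_def fps_nth_Abs_fps, rule stable)
  qed
  moreover have "L \<noteq> 0"
  proof -
    have "fps_nth L 0 = 1 + fls_X_inv + fls_X_inv ^ 2"
      by (simp add: L_def P_def phi_2_minus1_factor_def)
    then have "fls_nth (fps_nth L 0) 0 = 1"
      by (simp add: power2_eq_square fls_X_inv_times_conv_shift)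
    then show ?thesis by auto
  qed
  ultimately have "phi_2_minus1_factor has_prod L"
    by (simp add: has_prod_def raw_has_prod_def P_def[abs_def])
  then show ?thesis
    using has_prod_unique by metis
qed

lemma tendsto_phi_2_minus1_product:
  "(\<lambda>N. \<Prod>l\<le>N. phi_2_minus1_factor l) \<longlonglongrightarrow> prodinf phi_2_minus1_factor"
proof -
  have "phi_2_minus1_factor i \<noteq> 0" for i
  proof
    assume 0: "phi_2_minus1_factor i = 0"
    have "fls_nth (fps_nth (phi_2_minus1_factor i) 0) 0 = (1 :: int)"
      by (cases "i = 0") (simp_all add: phi_2_minus1_factor_def power2_eq_square
          fls_X_inv_times_conv_shift power_0_left)
    then show False by (simp add: 0)
  qed
  then show ?thesis
    using has_prod_phi_2_minus1_factor by (simp add: has_prod_def raw_has_prod_def)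
qed

end

theory Submission
  imports Defs
begin

text \<open>
  With $\omega$ a primitive cube root of unity, $1 + x + x^2 = (1 - \omega x)(1 - \omega^{-1} x)$
  splits the product into two Jacobi triple products, so that
  $(q;q)_\infty^2 \sum_n \phi_{2,-1}(n) q^n$ is supported on exponents of the form $m(m+1)$.
  Modulo 5 we have $(q;q)_\infty^{-2} \equiv (q;q)_\infty^3 / (q^5;q^5)_\infty$, and
  $(q;q)_\infty^3 = \sum_{k \ge 0} (-1)^k (2k+1) q^{k(k+1)/2}$. If
  $k(k+1)/2 + m(m+1) \equiv 4 \pmod 5$ then $(2k+1)^2 + 2(2m+1)^2 \equiv 0 \pmod 5$, which forces
  $5 \mid 2k+1$ because $-2$ is not a square modulo 5.

  All identities are used in finite form: for fixed $n$, the series $(q;q)_\infty$ is replaced by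
  $(q;q)_{2n}$ and everything is compared modulo $q^n$.
\<close>

section \<open>Gaussian binomial coefficients\<close>

text \<open>The q-Pascal recursion needs no division, so it makes sense in every commutative ring
  and is preserved by ring homomorphisms.\<close>

fun qbin :: "'a::comm_ring_1 \<Rightarrow> nat \<Rightarrow> nat \<Rightarrow> 'a" where
  "qbin q m 0 = 1"
| "qbin q 0 (Suc k) = 0"
| "qbin q (Suc m) (Suc k) = qbin q m k + q ^ Suc k * qbin q m (Suc k)"

text \<open>The finite q-Pochhammer symbol (q;q)_m.\<close>

definition qpoch :: "'a::comm_ring_1 \<Rightarrow> nat \<Rightarrow> 'a" where
  "qpoch q m = (\<Prod>j<m. 1 - q ^ Suc j)"

lemma qpoch_0 [simp]: "qpoch q 0 = 1"
  by (simp add: qpoch_def)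

lemma qpoch_Suc: "qpoch q (Suc m) = qpoch q m * (1 - q ^ Suc m)"
  by (simp add: qpoch_def)

lemma qbin_eq_0: "m < k \<Longrightarrow> qbin q m k = 0"
  by (induction q m k rule: qbin.induct) auto

lemma qbin_self [simp]: "qbin q m m = 1"
  by (induction m) (auto simp: qbin_eq_0)

lemma Suc_choose_two: "Suc k choose 2 = k + (k choose 2)"
  by (simp add: numeral_2_eq_2)

text \<open>Splitting off the factor j = 0 leaves the product for \<open>b * q\<close>; the q-Pascal
  rule recombines the two resulting sums. The homogeneous form admits a = q^n without
  division.\<close>

theorem q_binomial:
  "(\<Prod>j<m. a + b * q ^ j) = (\<Sum>k\<le>m. qbin q m k * q ^ (k choose 2) * a ^ (m - k) * b ^ k)"
proof (induction m arbitrary: b)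
  case (Suc m)
  define t where "t k = qbin q m k * q ^ (Suc k choose 2) * a ^ (m - k) * b ^ k" for k
  have "(\<Prod>j<Suc m. a + b * q ^ j) = (a + b) * (\<Prod>j<m. a + (b * q) * q ^ j)"
    by (simp add: prod.lessThan_Suc_shift mult_ac del: prod.lessThan_Suc)
  also have "(\<Prod>j<m. a + (b * q) * q ^ j) = (\<Sum>k\<le>m. t k)"
    unfolding Suc.IH t_def
    by (intro sum.cong refl) (simp add: Suc_choose_two power_add power_mult_distrib mult_ac)
  also have "(a + b) * (\<Sum>k\<le>m. t k) = (\<Sum>k\<le>m. a * t k) + (\<Sum>k\<le>m. b * t k)"
    by (simp only: distrib_right sum_distrib_left sum.distrib)
  also have "(\<Sum>k\<le>m. a * t k) = (\<Sum>k\<le>Suc m. a * t k)"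
    by (simp add: t_def qbin_eq_0)
  also have "\<dots> = a * t 0 + (\<Sum>k\<le>m. a * t (Suc k))"
    by (rule sum.atMost_Suc_shift)
  also have "a * t 0 + (\<Sum>k\<le>m. a * t (Suc k)) + (\<Sum>k\<le>m. b * t k) =
      a * t 0 + (\<Sum>k\<le>m. a * t (Suc k) + b * t k)"
    by (simp add: sum.distrib add.assoc)
  also have "(\<Sum>k\<le>m. a * t (Suc k) + b * t k) =
      (\<Sum>k\<le>m. qbin q (Suc m) (Suc k) * q ^ (Suc k choose 2) * a ^ (Suc m - Suc k) * b ^ Suc k)"
  proof (intro sum.cong refl)
    fix k assume "k \<in> {..m}"
    then consider "k = m" | d where "m = Suc (k + d)"
      by (auto simp: le_less dest: less_imp_Suc_add)
    then show "a * t (Suc k) + b * t k =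
        qbin q (Suc m) (Suc k) * q ^ (Suc k choose 2) * a ^ (Suc m - Suc k) * b ^ Suc k"
    proof cases
      case 1
      then show ?thesis by (simp add: t_def qbin_eq_0 mult_ac)
    next
      case 2
      then show ?thesis
        by (simp add: t_def Suc_choose_two[of "Suc k"] power_add algebra_simps Suc_diff_le
            del: qbin.simps) (simp add: algebra_simps)
    qed
  qed
  also have "a * t 0 = qbin q (Suc m) 0 * q ^ (0 choose 2) * a ^ (Suc m - 0) * b ^ 0"
    by (simp add: t_def numeral_2_eq_2)
  finally show ?case
    by (simp only: sum.atMost_Suc_shift)
qed (simp add: binomial_eq_0)

declare qbin.simps(3) [simp del]

text \<open>The quotient formula for Gaussian binomials with denominators cleared. The induction
  step rests on (1 - q^k) + q^k (1 - q^l) = 1 - q^(k+l).\<close>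

lemma qbin_mult_qpoch: "qbin q (k + l) k * (qpoch q k * qpoch q l) = qpoch q (k + l)"
proof (induction "k + l" arbitrary: k l)
  case (Suc m)
  show ?case
  proof (cases k)
    case [simp]: (Suc k')
    show ?thesis
    proof (cases l)
      case [simp]: (Suc l')
      have 1: "qbin q m k' * (qpoch q k' * qpoch q l) = qpoch q m"
        using Suc.hyps by (metis Suc_inject add_Suc \<open>k = Suc k'\<close>)
      have 2: "qbin q m k * (qpoch q k * qpoch q l') = qpoch q m"
        using Suc.hyps by (metis Suc_inject add_Suc_right \<open>l = Suc l'\<close>)
      have "qbin q (k + l) k * (qpoch q k * qpoch q l) =
          qbin q m k' * (qpoch q k' * qpoch q l) * (1 - q ^ k) +
          q ^ k * (qbin q m k * (qpoch q k * qpoch q l')) * (1 - q ^ l)"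
        unfolding Suc.hyps(2)[symmetric]
        by (simp add: qbin.simps(3) qpoch_Suc algebra_simps)
      also have "\<dots> = qpoch q m * (1 - q ^ (k + l))"
        unfolding 1 2 by (simp add: algebra_simps power_add)
      also have "\<dots> = qpoch q (k + l)"
        unfolding Suc.hyps(2)[symmetric] by (simp add: qpoch_Suc)
      finally show ?thesis .
    qed simp
  qed simp
qed simp

section \<open>The finite Jacobi triple product\<close>

text \<open>Writing $k = n + j$, this is the exponent $j(j-1)/2$, also for negative $j$.\<close>

definition jtp_exp :: "nat \<Rightarrow> nat \<Rightarrow> nat" where
  "jtp_exp n k = (if n \<le> k then (k - n) choose 2 else Suc (n - k) choose 2)"

lemma int_choose_two: "2 * int (m choose 2) = int m * (int m - 1)"
proof (induction m)
  case (Suc m)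
  then show ?case by (simp add: Suc_choose_two algebra_simps)
qed (simp add: numeral_2_eq_2)

lemma int_jtp_exp: "2 * int (jtp_exp n k) = (int k - int n) * (int k - int n - 1)"
  by (auto simp: jtp_exp_def int_choose_two of_nat_diff algebra_simps)

text \<open>With k = n + j, this is the invariance of j(j-1)/2 under j -> 1 - j.\<close>

lemma jtp_exp_reflect:
  assumes "k \<le> 2 * n + 1"
  shows "jtp_exp n (2 * n + 1 - k) = jtp_exp n k"
proof -
  have "2 * int (jtp_exp n (2 * n + 1 - k)) = 2 * int (jtp_exp n k)"
    unfolding int_jtp_exp using assms by (simp add: of_nat_diff algebra_simps)
  then show ?thesis by simp
qed

lemma choose_two_eq_jtp_exp:
  assumes "k \<le> 2 * n"
  shows "(k choose 2) + n * (2 * n - k) = (n choose 2) + n * n + jtp_exp n k"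
proof -
  have "2 * int ((k choose 2) + n * (2 * n - k)) = 2 * int ((n choose 2) + n * n + jtp_exp n k)"
    using assms int_choose_two[of k] int_choose_two[of n] int_jtp_exp[of n k]
    by (simp add: of_nat_diff distrib_left) (simp add: algebra_simps)
  then show ?thesis
    by (simp only: mult_cancel_left of_nat_eq_iff) simp
qed

lemma choose_two_ge: "m \<le> Suc (m choose 2)"
proof (induction m)
  case (Suc m)
  then show ?case by (cases m) (auto simp: Suc_choose_two)
qed simp

lemma prod_lessThan_add:
  "(\<Prod>i<m + n. g i) = (\<Prod>i<m. g i) * (\<Prod>i<n. g (m + i :: nat) :: 'a::comm_monoid_mult)"
  by (induction n) (simp_all add: mult.assoc)

text \<open>This is the q-binomial theorem with 2n factors, a = q^n and b = w. Both halves of the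
  product release powers of q, whose total \<open>q ^ M\<close> cancels. Writing q^(i+1) + w for 1 +
  w^-1 q^(i+1) keeps all exponents natural.\<close>

theorem finite_jacobi_triple_product:
  fixes q w :: "'a::idom"
  assumes "q \<noteq> 0"
  shows "(\<Prod>i<n. q ^ Suc i + w) * (\<Prod>i<n. 1 + w * q ^ i) =
    (\<Sum>k\<le>2 * n. qbin q (2 * n) k * q ^ jtp_exp n k * w ^ k)"
proof -
  define M where "M = (n choose 2) + n * n"
  have pq: "(\<Prod>i<n. q ^ i) = q ^ (n choose 2)"
  proof (induction n)
    case (Suc n)
    then show ?case by (simp only: prod.lessThan_Suc Suc_choose_two power_add mult.commute)
  qed (simp add: binomial_eq_0)
  \<comment> \<open>Taking q^i out of factor i leaves q^(n-i) + w; reversing the order turns n - i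
    into i + 1.\<close>
  have 1: "(\<Prod>i<n. q ^ n + w * q ^ i) = q ^ (n choose 2) * (\<Prod>i<n. q ^ Suc i + w)"
  proof -
    have "(\<Prod>i<n. q ^ n + w * q ^ i) = (\<Prod>i<n. q ^ i * (q ^ Suc (n - Suc i) + w))"
      by (intro prod.cong refl) (simp add: distrib_left flip: power_add power_Suc)
    also have "\<dots> = q ^ (n choose 2) * (\<Prod>i<n. q ^ Suc (n - Suc i) + w)"
      by (simp only: prod.distrib pq)
    also have "(\<Prod>i<n. q ^ Suc (n - Suc i) + w) = (\<Prod>i<n. q ^ Suc i + w)"
      by (rule prod.nat_diff_reindex)
    finally show ?thesis .
  qed
  have 2: "(\<Prod>i<n. q ^ n + w * q ^ (n + i)) = q ^ (n * n) * (\<Prod>i<n. 1 + w * q ^ i)"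
  proof -
    have "(\<Prod>i<n. q ^ n + w * q ^ (n + i)) = (\<Prod>i<n. q ^ n * (1 + w * q ^ i))"
      by (intro prod.cong refl) (simp add: algebra_simps power_add)
    then show ?thesis by (simp add: prod.distrib power_mult)
  qed
  have "q ^ M * ((\<Prod>i<n. q ^ Suc i + w) * (\<Prod>i<n. 1 + w * q ^ i)) =
      (\<Prod>i<n. q ^ n + w * q ^ i) * (\<Prod>i<n. q ^ n + w * q ^ (n + i))"
    unfolding 1 2 M_def by (simp add: power_add mult_ac)
  also have "\<dots> = (\<Prod>i<2 * n. q ^ n + w * q ^ i)"
    by (simp only: mult_2 prod_lessThan_add)
  also have "\<dots> =
      (\<Sum>k\<le>2 * n. qbin q (2 * n) k * q ^ (k choose 2) * (q ^ n) ^ (2 * n - k) * w ^ k)"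
    by (rule q_binomial)
  also have "\<dots> = (\<Sum>k\<le>2 * n. q ^ M * (qbin q (2 * n) k * q ^ jtp_exp n k * w ^ k))"
  proof (intro sum.cong refl)
    fix k assume "k \<in> {..2 * n}"
    then have eq: "q ^ (k choose 2) * (q ^ n) ^ (2 * n - k) = q ^ M * q ^ jtp_exp n k"
      unfolding M_def power_mult[symmetric] power_add[symmetric]
      by (subst choose_two_eq_jtp_exp) auto
    show "qbin q (2 * n) k * q ^ (k choose 2) * (q ^ n) ^ (2 * n - k) * w ^ k =
        q ^ M * (qbin q (2 * n) k * q ^ jtp_exp n k * w ^ k)"
      unfolding mult.assoc[of "qbin q (2 * n) k"] eq by (simp only: mult_ac)
  qed
  finally show ?thesis
    using assms by (simp flip: sum_distrib_left)
qed

section \<open>Power series modulo powers of the variable\<close>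

definition fps_eq_upto :: "nat \<Rightarrow> 'a::comm_ring_1 fps \<Rightarrow> 'a fps \<Rightarrow> bool" where
  "fps_eq_upto n f g \<longleftrightarrow> (\<forall>i<n. fps_nth f i = fps_nth g i)"

lemma fps_eq_upto_refl [simp]: "fps_eq_upto n f f"
  by (simp add: fps_eq_upto_def)

lemma fps_eq_upto_sym: "fps_eq_upto n f g \<Longrightarrow> fps_eq_upto n g f"
  by (simp add: fps_eq_upto_def)

lemma fps_eq_upto_trans [trans]:
  "fps_eq_upto n f g \<Longrightarrow> fps_eq_upto n g h \<Longrightarrow> fps_eq_upto n f h"
  by (simp add: fps_eq_upto_def)

lemma fps_eq_upto_mono: "fps_eq_upto n f g \<Longrightarrow> m \<le> n \<Longrightarrow> fps_eq_upto m f g"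
  by (simp add: fps_eq_upto_def)

lemma fps_eq_upto_mult:
  "fps_eq_upto n f g \<Longrightarrow> fps_eq_upto n f' g' \<Longrightarrow> fps_eq_upto n (f * f') (g * g')"
  by (auto simp: fps_eq_upto_def fps_mult_nth intro!: sum.cong)

lemma fps_eq_upto_sum:
  "(\<And>k. k \<in> A \<Longrightarrow> fps_eq_upto n (f k) (g k)) \<Longrightarrow> fps_eq_upto n (sum f A) (sum g A)"
  by (auto simp: fps_eq_upto_def fps_sum_nth intro!: sum.cong)

lemma fps_eq_upto_mult_X_power:
  "fps_eq_upto n f g \<Longrightarrow> fps_eq_upto (n + e) (f * fps_X ^ e) (g * fps_X ^ e)"
  by (auto simp: fps_eq_upto_def fps_X_power_mult_right_nth)

text \<open>As p has constant term 1, the coefficients of h are determined recursively by those of p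
  h.\<close>

lemma fps_eq_upto_cancel:
  fixes p :: "'a::comm_ring_1 fps"
  assumes "fps_nth p 0 = 1" "fps_eq_upto n (p * f) (p * g)"
  shows "fps_eq_upto n f g"
proof -
  have expand: "fps_nth (p * h) i = fps_nth h i + (\<Sum>j=1..i. fps_nth p j * fps_nth h (i - j))" for h i
    using assms(1) by (simp add: fps_mult_nth sum.atLeast_Suc_atMost)
  have "fps_nth f i = fps_nth g i" if "i < n" for i
    using that
  proof (induction i rule: less_induct)
    case (less i)
    have "(\<Sum>j=1..i. fps_nth p j * fps_nth f (i - j)) =
        (\<Sum>j=1..i. fps_nth p j * fps_nth g (i - j))"
      using less by (intro sum.cong) auto
    moreover have "fps_nth (p * f) i = fps_nth (p * g) i"
      using assms(2) less.prems by (simp add: fps_eq_upto_def)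
    ultimately show ?case
      unfolding expand by simp
  qed
  then show ?thesis by (simp add: fps_eq_upto_def)
qed

lemma qpoch_nth_0 [simp]: "fps_nth (qpoch fps_X m) 0 = (1::'a::comm_ring_1)"
  by (induction m) (simp_all add: qpoch_Suc)

text \<open>Every further factor 1 - q^j has j > k, so it is 1 modulo q^(k+1).\<close>

lemma qpoch_eq_upto:
  assumes "k \<le> m"
  shows "fps_eq_upto (Suc k) (qpoch fps_X k) (qpoch fps_X m :: 'a::comm_ring_1 fps)"
  using assms
proof (induction m rule: dec_induct)
  case (step m)
  have "fps_eq_upto (Suc k) (qpoch fps_X m * 1) (qpoch fps_X m * (1 - fps_X ^ Suc m :: 'a fps))"
    using step by (intro fps_eq_upto_mult) (auto simp: fps_eq_upto_def simp del: power_Suc)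
  then show ?case
    using step.IH by (auto simp: qpoch_Suc intro: fps_eq_upto_trans simp del: power_Suc)
qed simp

text \<open>The finite counterpart of central Gaussian binomials tending to 1/(q;q)_\<infinity>.
  Away from the centre the approximation is worse, but the power of q makes up for the lost
  precision.\<close>

lemma qpoch_mult_qbin_eq_upto:
  assumes "k \<le> 2 * n"
  shows "fps_eq_upto n (qpoch fps_X (2 * n) * qbin fps_X (2 * n) k * fps_X ^ jtp_exp n k)
    (fps_X ^ jtp_exp n k :: 'a::comm_ring_1 fps)"
proof -
  define p :: "'a fps" where "p = qpoch fps_X (2 * n)"
  define b :: "'a fps" where "b = qbin fps_X (2 * n) k"
  define r where "r = min k (2 * n - k)"
  have 1: "fps_eq_upto (Suc r) p (qpoch fps_X k)"
    and 2: "fps_eq_upto (Suc r) p (qpoch fps_X (2 * n - k))"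
    unfolding p_def using assms
    by (auto intro!: fps_eq_upto_sym[OF fps_eq_upto_mono[OF qpoch_eq_upto]] simp: r_def)
  have "fps_eq_upto (Suc r) (b * (p * p)) (b * (qpoch fps_X k * qpoch fps_X (2 * n - k)))"
    by (intro fps_eq_upto_mult 1 2 fps_eq_upto_refl)
  also have "b * (qpoch fps_X k * qpoch fps_X (2 * n - k)) = p"
    using qbin_mult_qpoch[of fps_X k "2 * n - k"] assms by (simp add: b_def p_def)
  finally have "fps_eq_upto (Suc r) (p * (p * b)) (p * 1)"
    by (simp add: mult_ac)
  then have "fps_eq_upto (Suc r) (p * b) 1"
    by (rule fps_eq_upto_cancel[rotated]) (simp add: p_def)
  from fps_eq_upto_mult_X_power[OF this, of "jtp_exp n k"]
  have "fps_eq_upto (Suc r + jtp_exp n k) (p * b * fps_X ^ jtp_exp n k) (fps_X ^ jtp_exp n k)"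
    by simp
  \<comment> \<open>Here r = n - |k - n|, and the exponent is at least |k - n| - 1.\<close>
  moreover have "n \<le> Suc r + jtp_exp n k"
    using choose_two_ge[of "k - n"] choose_two_ge[of "n - k"] assms
    by (auto simp: r_def jtp_exp_def min_def Suc_choose_two)
  ultimately show ?thesis
    unfolding p_def b_def by (rule fps_eq_upto_mono)
qed

section \<open>Jacobi's cube identity modulo 5\<close>

lemma qbin_const_poly: "qbin [:q:] m k = [:qbin q m k:]"
  by (induction q m k rule: qbin.induct) (simp_all add: qbin.simps(3) poly_const_pow pCons_one)

lemma poly_pderiv_linear_mult: "poly (pderiv ([:- a, 1:] * p)) a = poly p (a :: 'a::idom)"
  by (simp add: pderiv_mult pderiv_pCons del: mult_pCons_left)

lemma poly_pderiv_sum_monomials: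
  fixes x :: "'a::idom"
  shows "poly (pderiv (\<Sum>k\<in>A. smult (c k) ([:0, 1:] ^ k))) x =
      (\<Sum>k\<in>A. c k * (of_nat k * x ^ (k - 1)))"
  by (induction A rule: infinite_finite_induct)
    (simp_all add: pderiv_add pderiv_smult pderiv_power pderiv_pCons)

text \<open>Differentiate the triple product in $w$ at its zero $w = -1$.\<close>

theorem finite_jacobi_cube:
  fixes q :: "'a::idom"
  assumes "q \<noteq> 0" "n > 0"
  shows "(-1) ^ n * (qpoch q n * qpoch q (n - 1)) =
    (\<Sum>k\<le>2 * n. qbin q (2 * n) k * q ^ jtp_exp n k * (of_nat k * (-1) ^ (k - 1)))"
proof -
  \<comment> \<open>The triple product is taken over polynomials in w, with q as the constant
    \<open>Q\<close>; \<open>H\<close> is that product without its factor 1 + w.\<close>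
  define w :: "'a poly" where "w = [:0, 1:]"
  define Q where "Q = [:q:]"
  define H where "H = (\<Prod>i<n. Q ^ Suc i + w) * (\<Prod>i<n - 1. 1 + w * Q ^ Suc i)"
  have "Q \<noteq> 0" using assms(1) by (simp add: Q_def)
  have "[:- (- 1), 1:] * H = (\<Prod>i<n. Q ^ Suc i + w) * (\<Prod>i<n. 1 + w * Q ^ i)"
  proof -
    have "(\<Prod>i<n. 1 + w * Q ^ i) = (1 + w) * (\<Prod>i<n - 1. 1 + w * Q ^ Suc i)"
      using assms(2) by (cases n) (simp_all add: prod.lessThan_Suc_shift del: prod.lessThan_Suc)
    moreover have "[:- (- 1), 1:] = 1 + w"
      by (simp add: w_def one_pCons)
    ultimately show ?thesis by (simp only: H_def mult_ac)
  qed
  also have "\<dots> = (\<Sum>k\<le>2 * n. qbin Q (2 * n) k * Q ^ jtp_exp n k * w ^ k)"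
    by (rule finite_jacobi_triple_product) fact
  also have "\<dots> = (\<Sum>k\<le>2 * n. smult (qbin q (2 * n) k * q ^ jtp_exp n k) (w ^ k))"
    by (intro sum.cong refl) (simp add: Q_def qbin_const_poly poly_const_pow mult_ac)
  finally have "poly (pderiv ([:- (- 1), 1:] * H)) (-1) = poly (pderiv \<dots>) (-1)"
    by (rule arg_cong)
  then have "poly H (-1) = poly (pderiv (\<Sum>k\<le>2 * n.
      smult (qbin q (2 * n) k * q ^ jtp_exp n k) (w ^ k))) (-1)"
    by (simp only: poly_pderiv_linear_mult)
  \<comment> \<open>At k = 0 the truncated exponent \<open>k - 1\<close> does no harm, since
    \<open>of_nat k\<close> vanishes.\<close>
  also have "\<dots> =
      (\<Sum>k\<le>2 * n. qbin q (2 * n) k * q ^ jtp_exp n k * (of_nat k * (-1) ^ (k - 1)))"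
    unfolding w_def
    by (rule poly_pderiv_sum_monomials)
  also have "poly H (-1) = (\<Prod>i<n. q ^ Suc i - 1) * (\<Prod>i<n - 1. 1 - q ^ Suc i)"
    by (simp only: H_def Q_def w_def poly_mult poly_prod poly_add poly_power poly_const_pow)
      (simp add: algebra_simps)
  also have "(\<Prod>i<n. q ^ Suc i - 1) = (\<Prod>i<n. (-1) * (1 - q ^ Suc i))"
    by (intro prod.cong) auto
  also have "\<dots> = (-1) ^ n * qpoch q n"
    by (simp only: prod.distrib qpoch_def) simp
  finally show ?thesis
    by (simp only: qpoch_def mult.assoc)
qed

section \<open>Residues of the exponents modulo 5\<close>

text \<open>As 4x(x-1) + 1 = (2x-1)^2, the value 1 modulo 5 occurs only where 5 divides 2x - 1, that
  is at x = 3.\<close>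

lemma int_pred_mult_mod_5:
  fixes x :: int
  shows "x * (x - 1) mod 5 = 0 \<and> x mod 5 \<in> {0, 1} \<or>
    x * (x - 1) mod 5 = 2 \<and> x mod 5 \<in> {2, 4} \<or>
    x * (x - 1) mod 5 = 1 \<and> x mod 5 = 3"
proof -
  have "x mod 5 \<in> {0, 1, 2, 3, 4}"
    by (simp, presburger)
  moreover have "[x * (x - 1) = (x mod 5) * (x mod 5 - 1)] (mod 5)"
    by (intro cong_mult cong_diff) (auto simp: cong_def)
  then have "x * (x - 1) mod 5 = (x mod 5) * (x mod 5 - 1) mod 5"
    by (simp only: cong_def)
  ultimately show ?thesis
    by auto
qed

text \<open>Twice the exponent is x(x-1) with x = k - n. An exponent 3 modulo 5 has double 1, which
  makes the Jacobi weight 2x - 1 divisible by 5.\<close>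

lemma jtp_exp_mod_5:
  "2 * jtp_exp n k mod 5 \<in> {0, 1, 2}" (is ?A)
  "jtp_exp n k mod 5 = 3 \<Longrightarrow> 5 dvd (2 * int k - 2 * int n - 1)" (is "?P \<Longrightarrow> ?Q")
proof -
  define x where "x = int k - int n"
  have e: "2 * int (jtp_exp n k) = x * (x - 1)"
    by (simp add: int_jtp_exp x_def)
  have "int (2 * jtp_exp n k mod 5) = x * (x - 1) mod 5"
    by (simp add: e[symmetric] zmod_int)
  then show ?A
    using int_pred_mult_mod_5[of x] by auto
  assume ?P
  then have "int (jtp_exp n k) mod 5 = 3"
    by presburger
  then have "x * (x - 1) mod 5 = 1"
    unfolding e[symmetric] by presburger
  then have "x mod 5 = 3"
    using int_pred_mult_mod_5[of x] by auto
  then have "5 dvd (2 * x - 1)"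
    by presburger
  then show ?Q by (simp add: x_def)
qed

text \<open>The exponents j(j-1)/2 are 0, 1 or 3 modulo 5: residues 2 and 4 receive no term, and at
  residue 3 the weights are multiples of 5.\<close>

theorem qpoch_cube_nth_mod_5:
  assumes "r < n" "r mod 5 \<in> {2, 3, 4}"
  shows "5 dvd fps_nth (qpoch fps_X (2 * n) ^ 3 :: int fps) r"
proof -
  have "n > 0"
    using assms(1) by simp
  define p :: "int fps" where "p = qpoch fps_X (2 * n)"
  define c :: "nat \<Rightarrow> int" where "c k = int k * (-1) ^ (k - 1)" for k
  define s where "s = (\<Sum>k\<le>2 * n. if r = jtp_exp n k then c k else 0)"
  have m1: "(-1 :: int fps) = fps_const (-1)"
    by simp
  have c: "of_nat k * (-1) ^ (k - 1) = fps_const (c k)" for k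
    by (simp only: m1 c_def fps_of_nat[symmetric] fps_const_power fps_const_mult)
  \<comment> \<open>Two factors \<open>p\<close> become the symbols in the finite cube identity; the
    third absorbs the Gaussian binomials.\<close>
  have "fps_eq_upto n p (qpoch fps_X n)" "fps_eq_upto n p (qpoch fps_X (n - 1))"
    unfolding p_def by (auto intro!: fps_eq_upto_sym[OF fps_eq_upto_mono[OF qpoch_eq_upto]])
  then have "fps_eq_upto n ((-1) ^ n * (p * p) * p) ((-1) ^ n * (qpoch fps_X n * qpoch fps_X (n - 1)) * p)"
    by (intro fps_eq_upto_mult fps_eq_upto_refl)
  also have "(-1) ^ n * (qpoch fps_X n * qpoch fps_X (n - 1)) * p =
      (\<Sum>k\<le>2 * n. qbin fps_X (2 * n) k * fps_X ^ jtp_exp n k * fps_const (c k)) * p"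
    unfolding c[symmetric] using finite_jacobi_cube[of "fps_X :: int fps" n] \<open>n > 0\<close> by simp
  also have "\<dots> =
      (\<Sum>k\<le>2 * n. p * qbin fps_X (2 * n) k * fps_X ^ jtp_exp n k * fps_const (c k))"
    by (simp only: sum_distrib_right) (simp add: mult_ac)
  also have "fps_eq_upto n \<dots> (\<Sum>k\<le>2 * n. fps_X ^ jtp_exp n k * fps_const (c k))"
    unfolding p_def
    by (intro fps_eq_upto_sum fps_eq_upto_mult qpoch_mult_qbin_eq_upto fps_eq_upto_refl) simp
  finally have "fps_nth (fps_const ((-1) ^ n) * p ^ 3) r =
      fps_nth (\<Sum>k\<le>2 * n. fps_X ^ jtp_exp n k * fps_const (c k)) r"
    using assms(1) unfolding fps_eq_upto_def m1 fps_const_power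
    by (simp only: power3_eq_cube mult.assoc)
  also have "\<dots> = s"
    by (simp add: fps_sum_nth s_def fps_X_power_nth if_distrib[of "\<lambda>x. x * _"] cong: if_cong)
  finally have s: "(-1) ^ n * fps_nth (p ^ 3) r = s"
    by simp
  have "5 dvd s"
  proof (cases "r mod 5 = 3")
    case False
    have "r \<noteq> jtp_exp n k" for k
    proof
      assume "r = jtp_exp n k"
      then have "2 * r mod 5 \<in> {0, 1, 2}"
        using jtp_exp_mod_5(1) by simp
      moreover have "2 * r mod 5 = 2 * (r mod 5) mod 5"
        by (simp add: mod_mult_right_eq)
      ultimately show False
        using assms(2) False by auto
    qed
    then show ?thesis by (simp add: s_def)
  next
    case True
    \<comment> \<open>The terms for $k$ and $2n + 1 - k$ have the same exponent and add up to
      $\pm(2(k - n) - 1)$.\<close>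
    define g where "g k = (if r = jtp_exp n k then c k else 0)" for k
    \<comment> \<open>As \<open>c 0\<close> is 0, the term k = 0 drops out, and k -> 2n + 1 - k
      permutes the remaining range.\<close>
    have "s = (\<Sum>k=1..2 * n. g k)"
      unfolding s_def g_def[symmetric]
      by (rule sum.mono_neutral_right) (auto simp: g_def c_def)
    moreover have "\<dots> = (\<Sum>k=1..2 * n. g (2 * n + 1 - k))"
      by (rule sum.atLeastAtMost_rev)
    ultimately have "2 * s = (\<Sum>k=1..2 * n. g k + g (2 * n + 1 - k))"
      by (simp add: sum.distrib)
    also have "5 dvd \<dots>"
    proof (rule dvd_sum)
      fix k assume k: "k \<in> {1..2 * n}"
      show "5 dvd g k + g (2 * n + 1 - k)"
      proof (cases "r = jtp_exp n k")
        case r: True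
        obtain k' where k': "k = Suc k'" using k by (cases k) auto
        have "(-1) ^ (2 * n - k) = - ((-1) ^ k' :: int)"
          using k k' by (simp add: uminus_power_if)
        then have "g k + g (2 * n + 1 - k) = (-1) ^ k' * (2 * int k - 2 * int n - 1)"
          using k r jtp_exp_reflect[of k n]
          by (simp add: g_def c_def k' of_nat_diff) (simp add: algebra_simps)
        moreover have "5 dvd (2 * int k - 2 * int n - 1)"
          using jtp_exp_mod_5(2) r True by simp
        ultimately show ?thesis by simp
      next
        case False
        then show ?thesis using k jtp_exp_reflect[of k n] by (simp add: g_def)
      qed
    qed
    finally have "5 dvd 2 * s" .
    then show ?thesis by presburger
  qed
  then have "5 dvd (-1) ^ n * s" by simp
  also have "(-1) ^ n * s = fps_nth (p ^ 3) r"
    unfolding s[symmetric] by simp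
  finally show ?thesis unfolding p_def .
qed

section \<open>Coefficientwise homomorphisms\<close>

text \<open>The factorization with \<omega> takes place over the complex numbers, divisibility by 5
  over the integers; such maps carry identities between the coefficient rings.\<close>

locale coeff_hom =
  fixes f :: "'a::comm_ring_1 \<Rightarrow> 'b::comm_ring_1"
  assumes hom_add: "f (x + y) = f x + f y"
    and hom_mult: "f (x * y) = f x * f y"
    and hom_one: "f 1 = 1"
begin

lemma hom_zero: "f 0 = 0"
  using hom_add[of 0 0] by simp

lemma hom_minus: "f (x - y) = f x - f y"
  using hom_add[of "x - y" y] by simp

lemma hom_power: "f (x ^ n) = f x ^ n"
  by (induction n) (simp_all add: hom_one hom_mult)

lemma hom_sum: "f (sum g A) = (\<Sum>i\<in>A. f (g i))"
  by (induction A rule: infinite_finite_induct) (simp_all add: hom_zero hom_add)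

lemma hom_prod: "f (prod g A) = (\<Prod>i\<in>A. f (g i))"
  by (induction A rule: infinite_finite_induct) (simp_all add: hom_one hom_mult)

lemma hom_qbin: "f (qbin q m k) = qbin (f q) m k"
  by (induction q m k rule: qbin.induct)
    (simp_all add: qbin.simps(3) hom_zero hom_one hom_add hom_mult hom_power)

lemma hom_qpoch: "f (qpoch q m) = qpoch (f q) m"
  by (simp only: qpoch_def hom_prod hom_minus hom_one hom_power)

end

definition fps_map :: "('a::comm_ring_1 \<Rightarrow> 'b::comm_ring_1) \<Rightarrow> 'a fps \<Rightarrow> 'b fps" where
  "fps_map f g = Abs_fps (\<lambda>n. f (fps_nth g n))"

lemma fps_map_nth [simp]: "fps_nth (fps_map f g) n = f (fps_nth g n)"
  by (simp add: fps_map_def)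

context coeff_hom
begin

lemma coeff_hom_fps_map: "coeff_hom (fps_map f)"
  by standard (auto simp: fps_eq_iff hom_add hom_mult hom_sum fps_mult_nth hom_one hom_zero)

lemma fps_map_X: "fps_map f fps_X = fps_X"
  by (simp add: fps_eq_iff hom_zero hom_one)

lemma fps_map_const: "fps_map f (fps_const c) = fps_const (f c)"
  by (simp add: fps_eq_iff hom_zero)

end

section \<open>Extension of scalars from the integers to the complex numbers\<close>

definition fls_of_int_coeffs :: "int fls \<Rightarrow> complex fls" where
  "fls_of_int_coeffs g = Abs_fls (\<lambda>n. of_int (fls_nth g n))"

lemma fls_of_int_coeffs_nth [simp]: "fls_nth (fls_of_int_coeffs g) n = of_int (fls_nth g n)"
  unfolding fls_of_int_coeffs_def by (rule nth_Abs_fls_lower_bound[of "fls_subdegree g"]) simp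

text \<open>Equal subdegrees let the convolution sums for products in both rings run over the same
  range.\<close>

lemma fls_of_int_coeffs_subdegree [simp]: "fls_subdegree (fls_of_int_coeffs g) = fls_subdegree g"
proof (cases "g = 0")
  case True
  then have "fls_of_int_coeffs g = 0" by (simp add: fls_eq_iff)
  then show ?thesis using True by simp
next
  case False
  then show ?thesis by (intro fls_subdegree_eqI) auto
qed

interpretation of_int_hom: coeff_hom "of_int :: int \<Rightarrow> complex"
  by standard auto

interpretation fls_const_hom: coeff_hom "fls_const :: complex \<Rightarrow> complex fls"
  by standard (auto simp: fls_plus_const)

interpretation fls_of_int_hom: coeff_hom fls_of_int_coeffs
  by standard (auto simp: fls_eq_iff fls_times_nth(2))

interpretation fps_of_int_hom: coeff_hom "fps_map (of_int :: int \<Rightarrow> complex)"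
  by (rule of_int_hom.coeff_hom_fps_map)

interpretation fps_const_hom: coeff_hom "fps_map (fls_const :: complex \<Rightarrow> complex fls)"
  by (rule fls_const_hom.coeff_hom_fps_map)

interpretation fps_fls_of_int_hom: coeff_hom "fps_map fls_of_int_coeffs"
  by (rule fls_of_int_hom.coeff_hom_fps_map)

section \<open>The coefficient of \<open>z\<^sup>-\<^sup>1\<close> in the finite product\<close>

definition coeff_z_inv :: "'a::comm_ring_1 fls fps \<Rightarrow> 'a fps" where
  "coeff_z_inv g = Abs_fps (\<lambda>n. fls_nth (fps_nth g n) (-1))"

lemma coeff_z_inv_nth [simp]: "fps_nth (coeff_z_inv g) n = fls_nth (fps_nth g n) (-1)"
  by (simp add: coeff_z_inv_def)

lemma fls_nth_sum: "fls_nth (sum g A) n = (\<Sum>x\<in>A. fls_nth (g x) n)"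
  by (induction A rule: infinite_finite_induct) auto

lemma coeff_z_inv_sum: "coeff_z_inv (sum g A) = (\<Sum>x\<in>A. coeff_z_inv (g x))"
  by (simp add: fps_eq_iff fps_sum_nth fls_nth_sum)

lemma coeff_z_inv_monomial:
  fixes a :: "complex fps"
  shows "coeff_z_inv (fps_map fls_const a * fps_const (fls_X ^ m * fls_X_inv ^ k)) =
    (if k = m + 1 then a else 0)"
proof (rule fps_ext)
  fix n
  have "fls_nth (fls_X ^ m * fls_X_inv ^ k :: complex fls) (-1) = (if k = m + 1 then 1 else 0)"
    by (simp add: fls_X_power_times_conv_shift)
  then show "fps_nth (coeff_z_inv (fps_map fls_const a * fps_const (fls_X ^ m * fls_X_inv ^ k))) n =
      fps_nth (if k = m + 1 then a else 0) n"
    by simp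
qed

text \<open>The assumptions make c and c' roots of t^2 + t + 1. The homogeneous form serves both y =
  q^(l+1), x = w and y = 1, x = w q^l.\<close>

lemma omega_factor:
  fixes c c' x y :: "'a::comm_ring_1"
  assumes "c + c' = -1" "c * c' = 1"
  shows "y ^ 2 + x * y + x ^ 2 = (y - c * x) * (y - c' * x)"
proof -
  have "(y - c * x) * (y - c' * x) = y ^ 2 - (c + c') * (x * y) + (c * c') * x ^ 2"
    by (simp add: algebra_simps power2_eq_square)
  then show ?thesis by (simp add: assms)
qed

text \<open>Up to a power of z, the product is a product of two finite triple products, in
  -\<omega>/z and -\<omega>'/z; these supply u = -\<omega> and v = -\<omega>'.\<close>

lemma phi_finite_product_expansion:
  obtains u v :: complex where
    "coeff_z_inv (fps_map fls_of_int_coeffs (\<Prod>l<n. phi_2_minus1_factor l)) =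
      (\<Sum>k\<le>2 * n. \<Sum>k'\<le>2 * n. if k + k' = 2 * n + 1
        then qbin fps_X (2 * n) k * fps_X ^ jtp_exp n k *
          (qbin fps_X (2 * n) k' * fps_X ^ jtp_exp n k') * fps_const (u ^ k * v ^ k') else 0)"
proof -
  define \<omega> where "\<omega> = Complex (-1/2) (sqrt 3 / 2)"
  define \<omega>' where "\<omega>' = Complex (-1/2) (- sqrt 3 / 2)"
  have \<omega>: "\<omega> + \<omega>' = -1" "\<omega> * \<omega>' = 1"
    by (simp_all add: \<omega>_def \<omega>'_def complex_eq_iff)
  define K where "K = fps_map (fls_const :: complex \<Rightarrow> complex fls)"
  define c c' where "c = K (fps_const \<omega>)" and "c' = K (fps_const \<omega>')"
  have K_const: "K (fps_const x) = fps_const (fls_const x)" for x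
    by (simp add: K_def fls_const_hom.fps_map_const)
  have c: "c + c' = -1" "c * c' = 1"
    using \<omega> by (simp_all add: c_def c'_def K_const fls_plus_const)
  define z w q :: "complex fls fps"
    where "z = fps_const fls_X" and "w = fps_const fls_X_inv" and "q = fps_X"
  have zw: "z * w = 1"
    by (simp add: z_def w_def fls_X_times_conv_shift)
  define T where "T u = (\<Prod>i<n. q ^ Suc i + u) * (\<Prod>i<n. 1 + u * q ^ i)" for u
  define F where "F = fps_map fls_of_int_coeffs (\<Prod>l<n. phi_2_minus1_factor l)"
  define h where "h l = (1 + z * q ^ Suc l + (z * q ^ Suc l) ^ 2) * (1 + w * q ^ l + (w * q ^ l) ^ 2)" for l
  have X: "fls_of_int_coeffs fls_X = fls_X" "fls_of_int_coeffs fls_X_inv = fls_X_inv"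
    by (auto simp: fls_eq_iff)
  have "fps_map fls_of_int_coeffs (phi_2_minus1_factor l) = h l" for l
    unfolding phi_2_minus1_factor_def h_def z_def w_def q_def
    by (simp only: fps_fls_of_int_hom.hom_mult fps_fls_of_int_hom.hom_add fps_fls_of_int_hom.hom_one
      fps_fls_of_int_hom.hom_power fls_of_int_hom.fps_map_X fls_of_int_hom.fps_map_const
      fls_of_int_hom.hom_power X power_mult_distrib fps_const_power power_mult[symmetric] Suc_eq_plus1
      mult.commute[of 2])
  then have F: "F = (\<Prod>l<n. h l)"
    by (simp add: F_def fps_fls_of_int_hom.hom_prod)
  \<comment> \<open>Multiplying by w^2 = z^-2 replaces the powers of z in the first trinomial by
    powers of w, giving the factors q^(l+1) + u of \<open>T\<close>.\<close>
  have factor: "w ^ 2 * h l =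
      (q ^ Suc l + - c * w) * (1 + - c * w * q ^ l) * ((q ^ Suc l + - c' * w) * (1 + - c' * w * q ^ l))"
    for l
  proof -
    have "w ^ 2 * (1 + z * q ^ Suc l + (z * q ^ Suc l) ^ 2) =
        w ^ 2 + w * (z * w) * q ^ Suc l + (z * w) ^ 2 * (q ^ Suc l) ^ 2"
      by (simp add: power2_eq_square algebra_simps)
    also have "\<dots> = (q ^ Suc l) ^ 2 + w * q ^ Suc l + w ^ 2"
      by (simp add: zw)
    also have "\<dots> = (q ^ Suc l - c * w) * (q ^ Suc l - c' * w)"
      by (rule omega_factor[OF c])
    finally have 1: "w ^ 2 * (1 + z * q ^ Suc l + (z * q ^ Suc l) ^ 2) =
        (q ^ Suc l - c * w) * (q ^ Suc l - c' * w)" .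
    have 2: "1 + w * q ^ l + (w * q ^ l) ^ 2 = (1 - c * (w * q ^ l)) * (1 - c' * (w * q ^ l))"
      using omega_factor[OF c, of 1 "w * q ^ l"] by simp
    have "w ^ 2 * h l =
        (w ^ 2 * (1 + z * q ^ Suc l + (z * q ^ Suc l) ^ 2)) * (1 + w * q ^ l + (w * q ^ l) ^ 2)"
      by (simp only: h_def mult.assoc)
    also have "\<dots> =
        ((q ^ Suc l - c * w) * (q ^ Suc l - c' * w)) * ((1 - c * (w * q ^ l)) * (1 - c' * (w * q ^ l)))"
      by (simp only: 1 2)
    also have "\<dots> =
        (q ^ Suc l + - c * w) * (1 + - c * w * q ^ l) * ((q ^ Suc l + - c' * w) * (1 + - c' * w * q ^ l))"
      by (simp only: mult_minus_left add_uminus_conv_diff) (simp only: mult_ac)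
    finally show ?thesis .
  qed
  have "w ^ (2 * n) * F = (\<Prod>l<n. w ^ 2 * h l)"
    by (simp add: F prod.distrib power_mult)
  also have "\<dots> = T (- c * w) * T (- c' * w)"
    unfolding factor T_def by (simp only: prod.distrib mult_ac)
  \<comment> \<open>The power z^(2n) undoes the n factors w^2.\<close>
  finally have "z ^ (2 * n) * (w ^ (2 * n) * F) = z ^ (2 * n) * (T (- c * w) * T (- c' * w))"
    by simp
  then have F_eq: "F = z ^ (2 * n) * (T (- c * w) * T (- c' * w))"
    by (simp add: mult.assoc[symmetric] zw flip: power_mult_distrib)
  \<comment> \<open>Coefficients are collected under \<open>K\<close>, so that z occurs only in the
    powers of \<open>w\<close>.\<close>
  have T_eq: "T (- K (fps_const x) * w) =
      (\<Sum>k\<le>2 * n. K (qbin fps_X (2 * n) k * fps_X ^ jtp_exp n k * fps_const ((- x) ^ k)) * w ^ k)" for x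
  proof -
    have K_X: "K fps_X = q" by (simp add: K_def q_def fls_const_hom.fps_map_X)
    have "T (- K (fps_const x) * w) = T (K (fps_const (- x)) * w)"
      by (simp add: K_const)
    also have "\<dots> =
        (\<Sum>k\<le>2 * n. qbin q (2 * n) k * q ^ jtp_exp n k * (K (fps_const (- x)) * w) ^ k)"
      unfolding T_def by (rule finite_jacobi_triple_product) (simp add: q_def)
    also have "\<dots> =
        (\<Sum>k\<le>2 * n. K (qbin fps_X (2 * n) k * fps_X ^ jtp_exp n k * fps_const ((- x) ^ k)) * w ^ k)"
      unfolding K_X[symmetric] K_def
      by (simp only: power_mult_distrib fps_const_hom.hom_mult fps_const_hom.hom_qbin
        fps_const_hom.hom_power fps_const_power[symmetric] mult.assoc)
    finally show ?thesis .
  qed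
  let ?a = "\<lambda>x k. qbin fps_X (2 * n) k * fps_X ^ jtp_exp n k * fps_const ((- x) ^ k)"
  have "F =
      (\<Sum>k\<le>2 * n. \<Sum>k'\<le>2 * n. z ^ (2 * n) * ((K (?a \<omega> k) * w ^ k) * (K (?a \<omega>' k') * w ^ k')))"
    unfolding F_eq c_def c'_def T_eq sum_product unfolding sum_distrib_left ..
  also have "\<dots> = (\<Sum>k\<le>2 * n. \<Sum>k'\<le>2 * n.
      K (?a \<omega> k * ?a \<omega>' k') * fps_const (fls_X ^ (2 * n) * fls_X_inv ^ (k + k')))"
  proof (intro sum.cong refl)
    fix k k'
    have "fps_const (fls_X ^ (2 * n) * fls_X_inv ^ (k + k')) = z ^ (2 * n) * (w ^ k * w ^ k')"
      by (simp add: z_def w_def fps_const_power power_add)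
    then show "z ^ (2 * n) * ((K (?a \<omega> k) * w ^ k) * (K (?a \<omega>' k') * w ^ k')) =
        K (?a \<omega> k * ?a \<omega>' k') * fps_const (fls_X ^ (2 * n) * fls_X_inv ^ (k + k'))"
      unfolding K_def by (simp only: fps_const_hom.hom_mult mult_ac)
  qed
  \<comment> \<open>The monomial z^(2n) w^(k+k') equals z^-1 exactly when k + k' = 2n + 1.\<close>
  finally have "coeff_z_inv F =
      (\<Sum>k\<le>2 * n. \<Sum>k'\<le>2 * n. if k + k' = 2 * n + 1 then ?a \<omega> k * ?a \<omega>' k' else 0)"
    unfolding K_def by (simp only: coeff_z_inv_sum coeff_z_inv_monomial)
  also have "\<dots> = (\<Sum>k\<le>2 * n. \<Sum>k'\<le>2 * n. if k + k' = 2 * n + 1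
        then qbin fps_X (2 * n) k * fps_X ^ jtp_exp n k *
          (qbin fps_X (2 * n) k' * fps_X ^ jtp_exp n k') * fps_const ((- \<omega>) ^ k * (- \<omega>') ^ k') else 0)"
    by (intro sum.cong refl if_cong) (simp only: fps_const_mult[symmetric] mult_ac)
  finally show ?thesis
    unfolding F_def by (rule that)
qed

text \<open>The indices k and k' = 2n + 1 - k have equal exponents, so only powers q^(x(x-1)) with x
  = k - n survive; x(x-1) is never 3 or 4 modulo 5.\<close>

theorem qpoch_square_mult_nth_eq_0:
  assumes "s < n" "s mod 5 \<in> {3, 4}"
  shows "fps_nth (qpoch fps_X (2 * n) ^ 2 * coeff_z_inv (\<Prod>l<n. phi_2_minus1_factor l)) s = 0"
proof -
  define G where "G = coeff_z_inv (\<Prod>l<n. phi_2_minus1_factor l)"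
  define p :: "complex fps" where "p = qpoch fps_X (2 * n)"
  let ?b = "\<lambda>k. qbin fps_X (2 * n) k * fps_X ^ jtp_exp n k"
  obtain u v :: complex where uv:
    "coeff_z_inv (fps_map fls_of_int_coeffs (\<Prod>l<n. phi_2_minus1_factor l)) =
      (\<Sum>k\<le>2 * n. \<Sum>k'\<le>2 * n. if k + k' = 2 * n + 1
        then ?b k * ?b k' * fps_const (u ^ k * v ^ k') else 0)"
    by (rule phi_finite_product_expansion)
  \<comment> \<open>The coefficient is computed over the complex numbers; injectivity of
    \<open>of_int\<close> brings its vanishing back to the integers.\<close>
  have "fps_map of_int G = coeff_z_inv (fps_map fls_of_int_coeffs (\<Prod>l<n. phi_2_minus1_factor l))"
    by (simp add: fps_eq_iff G_def)
  then have lhs: "fps_map of_int (qpoch fps_X (2 * n) ^ 2 * G) = p ^ 2 * \<dots>"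
    by (simp only: fps_of_int_hom.hom_mult fps_of_int_hom.hom_power fps_of_int_hom.hom_qpoch
      of_int_hom.fps_map_X p_def)
  \<comment> \<open>Each of the two factors \<open>p\<close> is assigned to one Gaussian
    binomial.\<close>
  have expand: "p ^ 2 * coeff_z_inv (fps_map fls_of_int_coeffs (\<Prod>l<n. phi_2_minus1_factor l)) =
      (\<Sum>k\<le>2 * n. \<Sum>k'\<le>2 * n. if k + k' = 2 * n + 1
        then (p * ?b k) * (p * ?b k') * fps_const (u ^ k * v ^ k') else 0)"
    unfolding uv sum_distrib_left
    by (intro sum.cong refl) (simp add: power2_eq_square mult_ac)
  have "fps_eq_upto n (fps_map of_int (qpoch fps_X (2 * n) ^ 2 * G))
      (\<Sum>k\<le>2 * n. \<Sum>k'\<le>2 * n. if k + k' = 2 * n + 1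
        then fps_X ^ jtp_exp n k * fps_X ^ jtp_exp n k' * fps_const (u ^ k * v ^ k') else 0)"
    unfolding lhs expand
  proof (intro fps_eq_upto_sum)
    fix k k' assume "k \<in> {..2 * n}" "k' \<in> {..2 * n}"
    then have "fps_eq_upto n (p * ?b k) (fps_X ^ jtp_exp n k)" "fps_eq_upto n (p * ?b k') (fps_X ^ jtp_exp n k')"
      unfolding p_def mult.assoc[symmetric] by (auto intro: qpoch_mult_qbin_eq_upto)
    then show "fps_eq_upto n
        (if k + k' = 2 * n + 1 then (p * ?b k) * (p * ?b k') * fps_const (u ^ k * v ^ k') else 0)
        (if k + k' = 2 * n + 1 then fps_X ^ jtp_exp n k * fps_X ^ jtp_exp n k' * fps_const (u ^ k * v ^ k') else 0)"
      by (auto intro!: fps_eq_upto_mult)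
  qed
  then have "of_int (fps_nth (qpoch fps_X (2 * n) ^ 2 * G) s) =
      (\<Sum>k\<le>2 * n. \<Sum>k'\<le>2 * n. fps_nth (if k + k' = 2 * n + 1
        then fps_X ^ jtp_exp n k * fps_X ^ jtp_exp n k' * fps_const (u ^ k * v ^ k') else 0) s)"
    using assms(1) by (simp only: fps_eq_upto_def fps_map_nth[symmetric] fps_sum_nth)
  also have "\<dots> = 0"
  proof (intro sum.neutral ballI)
    fix k k' assume "k \<in> {..2 * n}" "k' \<in> {..2 * n}"
    show "fps_nth (if k + k' = 2 * n + 1
        then fps_X ^ jtp_exp n k * fps_X ^ jtp_exp n k' * fps_const (u ^ k * v ^ k') else 0) s = 0"
    proof (cases "k + k' = 2 * n + 1")
      case True
      then have "k' = 2 * n + 1 - k" "k \<le> 2 * n + 1" by auto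
      then have "jtp_exp n k' = jtp_exp n k" by (simp only: jtp_exp_reflect)
      moreover have "s \<noteq> 2 * jtp_exp n k"
        using jtp_exp_mod_5(1)[of n k] assms(2) by auto
      ultimately show ?thesis
        by (simp add: True fps_X_power_nth mult_2 flip: power_add)
    qed simp
  qed
  finally show ?thesis
    by (simp add: G_def)
qed

section \<open>The congruence\<close>

text \<open>Modulo 5, the hypotheses describe series in q^5, and these are closed under
  multiplication.\<close>

lemma fps_mult_nth_dvd_5:
  fixes f g :: "int fps"
  assumes "\<And>k. \<not> 5 dvd k \<Longrightarrow> 5 dvd fps_nth f k"
    "\<And>k. \<not> 5 dvd k \<Longrightarrow> 5 dvd fps_nth g k" "\<not> 5 dvd k"
  shows "5 dvd fps_nth (f * g) k"
  unfolding fps_mult_nth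
proof (rule dvd_sum)
  fix i assume "i \<in> {0..k}"
  then have "\<not> 5 dvd i \<or> \<not> 5 dvd (k - i)"
    using assms(3) dvd_add[of 5 i "k - i"] by auto
  then show "5 dvd fps_nth f i * fps_nth g (k - i)"
    using assms(1,2) by (auto intro: dvd_mult dvd_mult2)
qed

text \<open>By the Frobenius congruence (1 - x)^5 = 1 - x^5 modulo 5, each factor contributes a
  series in q^5.\<close>

lemma qpoch_fifth_power_nth:
  assumes "\<not> 5 dvd k"
  shows "5 dvd fps_nth (qpoch fps_X m ^ 5 :: int fps) k"
  using assms
proof (induction m arbitrary: k)
  case 0
  then show ?case by (cases k) simp_all
next
  case (Suc m)
  define x :: "int fps" where "x = fps_X ^ Suc m"
  have "(1 - x) ^ 5 = 1 - x ^ 5 + 5 * (- x + 2 * x ^ 2 - 2 * x ^ 3 + x ^ 4)"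
    by (simp add: eval_nat_numeral algebra_simps)
  also have "x ^ 5 = fps_X ^ (5 * Suc m)"
    unfolding x_def by (simp only: power_mult[symmetric] mult.commute)
  finally have expand: "(1 - x) ^ 5 =
    1 - fps_X ^ (5 * Suc m) + 5 * (- x + 2 * x ^ 2 - 2 * x ^ 3 + x ^ 4)" .
  have "5 dvd fps_nth ((1 - x) ^ 5) k" if "\<not> 5 dvd k" for k
  proof -
    have "k \<noteq> 0" "k \<noteq> 5 * Suc m" using that by (metis dvd_0_right, metis dvd_triv_left)
    then have "fps_nth ((1 - x) ^ 5) k = 5 * fps_nth (- x + 2 * x ^ 2 - 2 * x ^ 3 + x ^ 4) k"
      unfolding expand by (simp add: fps_X_power_nth numeral_fps_const del: mult_Suc_right)
    then show ?thesis by simp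
  qed
  then show ?case
    unfolding qpoch_Suc power_mult_distrib x_def[symmetric]
    by (intro fps_mult_nth_dvd_5 Suc.IH Suc.prems)
qed

text \<open>Instead of dividing by (q^5;q^5), the coefficients of p^5 G = p^3 (p^2 G) are compared,
  and induction on t removes the earlier coefficients of G.\<close>

lemma finite_product_nth_mod_5:
  assumes "5 * t + 4 < n"
  shows "5 dvd fps_nth (coeff_z_inv (\<Prod>l<n. phi_2_minus1_factor l)) (5 * t + 4)"
  using assms
proof (induction t rule: less_induct)
  case (less t)
  define G where "G = coeff_z_inv (\<Prod>l<n. phi_2_minus1_factor l)"
  define p :: "int fps" where "p = qpoch fps_X (2 * n)"
  define N where "N = 5 * t + 4"
  have "5 dvd fps_nth (p ^ 3 * (p ^ 2 * G)) N"
    unfolding fps_mult_nth[of "p ^ 3"]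
  proof (rule dvd_sum)
    fix r assume r: "r \<in> {0..N}"
    show "5 dvd fps_nth (p ^ 3) r * fps_nth (p ^ 2 * G) (N - r)"
    proof (cases "r mod 5 \<in> {2, 3, 4}")
      case True
      then have "5 dvd fps_nth (p ^ 3) r"
        unfolding p_def using r less.prems by (intro qpoch_cube_nth_mod_5) (auto simp: N_def)
      then show ?thesis by simp
    next
      case False
      \<comment> \<open>As N is 4 modulo 5, residues 0 and 1 of r leave 4 and 3 for N - r.\<close>
      have "(N - r) mod 5 \<in> {3, 4}"
      proof -
        have "r mod 5 < 5" by simp
        then have b: "r mod 5 = 0 \<or> r mod 5 = 1"
          using False by auto
        have "r = 5 * (r div 5) + r mod 5" by simp
        moreover have "r div 5 \<le> t"
          using r div_le_mono[of r N 5] by (simp add: N_def)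
        ultimately have "N - r = 5 * (t - r div 5) + (4 - r mod 5)"
          using b unfolding N_def by linarith
        then show ?thesis
          using b by auto
      qed
      then have "fps_nth (p ^ 2 * G) (N - r) = 0"
        unfolding p_def G_def using r less.prems
        by (intro qpoch_square_mult_nth_eq_0) (auto simp: N_def)
      then show ?thesis by simp
    qed
  qed
  also have "p ^ 3 * (p ^ 2 * G) = p ^ 5 * G"
    by (simp flip: mult.assoc power_add)
  also have "fps_nth (p ^ 5 * G) N =
      fps_nth G N + (\<Sum>i=1..N. fps_nth (p ^ 5) i * fps_nth G (N - i))"
    by (simp add: fps_mult_nth sum.atLeast_Suc_atMost p_def fps_nth_power_0)
  finally have "5 dvd fps_nth G N + (\<Sum>i=1..N. fps_nth (p ^ 5) i * fps_nth G (N - i))" .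
  \<comment> \<open>Only i = 5j matters modulo 5, and then N - i = 5(t-j) + 4 falls under the
    induction hypothesis.\<close>
  moreover have "5 dvd (\<Sum>i=1..N. fps_nth (p ^ 5) i * fps_nth G (N - i))"
  proof (rule dvd_sum)
    fix i assume i: "i \<in> {1..N}"
    show "5 dvd fps_nth (p ^ 5) i * fps_nth G (N - i)"
    proof (cases "5 dvd i")
      case True
      then obtain j where j: "i = 5 * j" by auto
      then have "N - i = 5 * (t - j) + 4" "t - j < t"
        using i by (auto simp: N_def)
      then have "5 dvd fps_nth G (N - i)"
        using less.IH[of "t - j"] less.prems by (simp add: G_def)
      then show ?thesis by simp
    next
      case False
      then show ?thesis unfolding p_def by (intro dvd_mult2 qpoch_fifth_power_nth)
    qed
  qed
  ultimately show ?case
    unfolding G_def N_def by (simp add: dvd_add_left_iff)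
qed

text \<open>Factor l is 1 modulo q^l, so factors from n onwards do not affect coefficients below
  n.\<close>

lemma phi_2_minus1_eq_finite_product:
  assumes "N < n"
  shows "phi_2_minus1 N = fps_nth (coeff_z_inv (\<Prod>l<n. phi_2_minus1_factor l)) N"
proof -
  let ?P = "\<lambda>m. \<Prod>l<m. phi_2_minus1_factor l"
  have stable: "fps_eq_upto n (?P n) (?P m)" if "n \<le> m" for m
    using that
  proof (induction m rule: dec_induct)
    case (step m)
    obtain g where "phi_2_minus1_factor m = 1 + fps_X ^ m * g"
      using phi_2_minus1_factor_eq_1_plus by blast
    then have "fps_eq_upto n 1 (phi_2_minus1_factor m)"
      using step by (auto simp: fps_eq_upto_def fps_X_power_mult_nth)
    then have "fps_eq_upto n (?P n * 1) (?P m * phi_2_minus1_factor m)"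
      by (intro fps_eq_upto_mult step.IH)
    then show ?case by simp
  qed simp
  have "\<forall>\<^sub>F m in sequentially. fps_nth (\<Prod>l\<le>m. phi_2_minus1_factor l) N =
      fps_nth (prodinf phi_2_minus1_factor) N"
    using tendsto_phi_2_minus1_product by (simp add: tendsto_fps_iff)
  then obtain M where M: "\<And>m. m \<ge> M \<Longrightarrow>
      fps_nth (\<Prod>l\<le>m. phi_2_minus1_factor l) N = fps_nth (prodinf phi_2_minus1_factor) N"
    by (auto simp: eventually_sequentially)
  \<comment> \<open>The bound \<open>max M n\<close> lies past the point where the limit is attained
    and past n; \<open>Suc\<close> converts l \<le> m to l < m + 1.\<close>
  have "fps_nth (prodinf phi_2_minus1_factor) N = fps_nth (?P (Suc (max M n))) N"
    unfolding lessThan_Suc_atMost by (rule M[symmetric]) simp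
  also have "\<dots> = fps_nth (?P n) N"
    using stable[of "Suc (max M n)"] assms by (simp add: fps_eq_upto_def del: prod.lessThan_Suc)
  finally show ?thesis
    by (simp add: phi_2_minus1_def)
qed

theorem theorem5:
  fixes n :: nat
  shows "[phi_2_minus1 (5 * n + 4) = 0] (mod 5)"
  \<comment> \<open>The truncation length 5n + 5 is the least one exceeding 5n + 4.\<close>
  using finite_product_nth_mod_5[of n "5 * n + 5"]
  by (simp add: phi_2_minus1_eq_finite_product[of _ "5 * n + 5"] cong_0_iff)

end
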